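(* Let $\tau>0$ and $N\ge1$, and let $\Phi_N=\{P_k\}_{k=0}^N$ be the Legendre polynomials shifted to $[-\tau,0]$. Let $r_N(s,\cdot)$ be, for all but finitely many $s\in\mathbb C$, the unique polynomial of degree at most $N$ on $[-\tau,0]$ satisfying $r_N(s,0)=1$ and $\mathcal D r_N(s,\cdot)=s\,\mathcal T_{N-1}r_N(s,\cdot)$. Then the rational function $s\mapsto r_N(s,-\tau)$ is an $(N,N)$ Padé approximant of $e^{-\tau s}$ near zero.
   Context: The shifted Legendre polynomials $P_k$ ($k\ge 0$) are the polynomials of degree $k$ that are orthogonal with respect to $\langle f,g\rangle=\int_{-\tau}^0 f(\theta)\overline{g(\theta)}\,d\theta$, normalized by $P_k(0)=1$. Let $\|f\|=\sqrt{\langle f,f\rangle}$. $\mathcal D f=f'$, and for a polynomial $f$ of degree at most $N$, $\mathcal T_{N-1}f=f-\frac{\langle f,P_N\rangle}{\|P_N\|^2}P_N$. A rational function $R$ is an $(N,N)$ Padé approximant of $e^{-\tau s}$ near zero if it is a quotient of two polynomials of degree at most $N$, is analytic at $0$, and its derivatives at zero satisfy $R^{(m)}(0)=(-\tau)^m$ for all $0\le m\le 2N$. For each fixed $\theta$, $s\mapsto r_N(s,\theta)$ is a rational function of $s$. *)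

theory Defs
  imports "HOL-Complex_Analysis.Complex_Analysis" "HOL-Computational_Algebra.Polynomial"
begin

text \<open>
  Polynomials on \<open>[-\<tau>, 0]\<close> have complex coefficients and are represented by the type
  \<^typ>\<open>complex poly\<close>; for \<open>\<tau> > 0\<close> such a polynomial is determined by its values on the interval.
\<close>

definition inner_on :: "real \<Rightarrow> complex poly \<Rightarrow> complex poly \<Rightarrow> complex" where
  "inner_on \<tau> f g =
     integral {-\<tau>..0} (\<lambda>\<theta>::real. poly f (of_real \<theta>) * cnj (poly g (of_real \<theta>)))"

text \<open>\<^term>\<open>inner_on \<tau> f f\<close> is real and nonnegative, so \<^const>\<open>Re\<close> is only a type conversion.\<close>

definition norm_on :: "real \<Rightarrow> complex poly \<Rightarrow> real" where
  "norm_on \<tau> f = sqrt (Re (inner_on \<tau> f f))"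

definition shifted_Legendre :: "real \<Rightarrow> (nat \<Rightarrow> complex poly) \<Rightarrow> bool" where
  "shifted_Legendre \<tau> P \<longleftrightarrow>
     (\<forall>k. degree (P k) = k \<and> poly (P k) 0 = 1) \<and>
     (\<forall>j k. j \<noteq> k \<longrightarrow> inner_on \<tau> (P j) (P k) = 0)"

text \<open>
  \<open>truncation \<tau> P N\<close> is the operator \<open>\<T>\<close> with index \<open>N - 1\<close>: it removes the component
  along \<open>P N\<close>. It is only meant for polynomials of degree at most \<open>N\<close>.
\<close>

definition truncation ::
    "real \<Rightarrow> (nat \<Rightarrow> complex poly) \<Rightarrow> nat \<Rightarrow> complex poly \<Rightarrow> complex poly" where
  "truncation \<tau> P N f =
     f - smult (inner_on \<tau> f (P N) / of_real ((norm_on \<tau> (P N))\<^sup>2)) (P N)"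

definition tau_solution ::
    "real \<Rightarrow> (nat \<Rightarrow> complex poly) \<Rightarrow> nat \<Rightarrow> complex \<Rightarrow> complex poly \<Rightarrow> bool" where
  "tau_solution \<tau> P N s f \<longleftrightarrow>
     degree f \<le> N \<and> poly f 0 = 1 \<and> pderiv f = smult s (truncation \<tau> P N f)"

text \<open>The value is unspecified at those \<open>s\<close> where the solution does not exist or is not unique.\<close>

definition r_N :: "real \<Rightarrow> (nat \<Rightarrow> complex poly) \<Rightarrow> nat \<Rightarrow> complex \<Rightarrow> complex poly" where
  "r_N \<tau> P N s = (THE f. tau_solution \<tau> P N s f)"

text \<open>
  A rational function is given as a total function that agrees with a quotient of polynomials
  off a finite set, so its values at poles are irrelevant. Analyticity at \<open>0\<close> and the
  derivatives at \<open>0\<close> refer to the function itself.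
\<close>

definition Pade_exp :: "real \<Rightarrow> nat \<Rightarrow> (complex \<Rightarrow> complex) \<Rightarrow> bool" where
  "Pade_exp \<tau> N R \<longleftrightarrow>
     (\<exists>p q. q \<noteq> 0 \<and> degree p \<le> N \<and> degree q \<le> N \<and>
        (\<forall>\<^sub>F s in cofinite. R s = poly p s / poly q s)) \<and>
     R analytic_on {0} \<and>
     (\<forall>m\<le>2 * N. (deriv ^^ m) R 0 = (- of_real \<tau>) ^ m)"

end

theory Submission
  imports Defs
begin

text \<open>
  Put \<open>N = degree p\<close> for \<open>p = P N\<close>. Orthogonality makes the truncation cancel exactly the
  coefficient of degree \<open>N\<close>, so the solution is a multiple of
  \<open>G s \<theta> = (\<Sum>k\<le>N. s ^ (N - k) * p^(k) \<theta>)\<close>, namely \<open>G s \<theta> / G s 0\<close>. Since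
  \<open>d/d\<theta> (exp (- s \<theta>) * G s \<theta>) = - s ^ (N + 1) * exp (- s \<theta>) * p \<theta>\<close>, integration over
  \<open>[-\<tau>, 0]\<close> and orthogonality of \<open>p\<close> to \<open>\<theta> ^ n\<close> for \<open>n < N\<close> show that
  \<open>G s 0 - exp (s \<tau>) * G s (-\<tau>)\<close> vanishes to order \<open>2 N + 1\<close> at \<open>s = 0\<close>. This last step is
  carried out coefficientwise, for formal power series in \<open>s\<close> over the polynomials in \<open>\<theta>\<close>.
\<close>

section \<open>Orthogonality\<close>

lemma integrable_inner_on:
  "(\<lambda>\<theta>::real. poly f (of_real \<theta>) * cnj (poly g (of_real \<theta>))) integrable_on {-\<tau>..0}"
  by (intro integrable_continuous_interval continuous_intros)

lemma inner_on_add_left: "inner_on \<tau> (f + g) h = inner_on \<tau> f h + inner_on \<tau> g h"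
  unfolding inner_on_def by (simp add: ring_distribs integral_add integrable_inner_on)

lemma inner_on_smult_left: "inner_on \<tau> (smult c f) h = c * inner_on \<tau> f h"
  unfolding inner_on_def by (simp add: mult.assoc)

lemma inner_on_0_left: "inner_on \<tau> 0 h = 0"
  by (simp add: inner_on_def)

lemma inner_on_self_eq:
  "inner_on \<tau> f f = of_real (integral {-\<tau>..0} (\<lambda>\<theta>. (cmod (poly f (of_real \<theta>)))\<^sup>2))"
proof -
  have "(\<lambda>\<theta>. (cmod (poly f (of_real \<theta>)))\<^sup>2) integrable_on {-\<tau>..0}"
    by (intro integrable_continuous_interval continuous_intros)
  from has_integral_of_real[OF integrable_integral[OF this], where 'b = complex]
  show ?thesis
    unfolding inner_on_def by (intro integral_unique) (simp flip: complex_norm_square)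
qed

text \<open>Nonnegativity of the integral cancels the square root, so the denominator in
  \<open>truncation\<close> becomes an inner product.\<close>

lemma of_real_norm_on_power2: "of_real ((norm_on \<tau> f)\<^sup>2) = inner_on \<tau> f f"
proof -
  have "integral {-\<tau>..0} (\<lambda>\<theta>. (cmod (poly f (of_real \<theta>)))\<^sup>2) \<ge> 0"
    by (rule integral_nonneg) (auto intro!: integrable_continuous_interval continuous_intros)
  then show ?thesis by (simp add: norm_on_def inner_on_self_eq)
qed

text \<open>A continuous nonnegative integrand with zero integral vanishes, so \<open>f\<close>
  would have the whole infinite interval as roots.\<close>

lemma inner_on_self_neq_0:
  assumes "\<tau> > 0" "f \<noteq> 0"
  shows "inner_on \<tau> f f \<noteq> 0"
proof
  assume "inner_on \<tau> f f = 0"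
  then have "integral {-\<tau>..0} (\<lambda>\<theta>. (cmod (poly f (of_real \<theta>)))\<^sup>2) = 0"
    by (simp add: inner_on_self_eq)
  then have "poly f (of_real \<theta>) = 0" if "\<theta> \<in> {-\<tau>..0}" for \<theta>
    using that assms(1)
    by (subst (asm) integral_eq_0_iff) (auto intro!: continuous_intros)
  then have "complex_of_real ` {-\<tau>..0} \<subseteq> {z. poly f z = 0}" by auto
  moreover have "infinite (complex_of_real ` {-\<tau>..0})"
    using assms(1) by (subst finite_image_iff) (auto simp: inj_on_def)
  ultimately show False
    using poly_roots_finite[OF assms(2)] finite_subset by blast
qed

lemma shifted_LegendreD:
  assumes "shifted_Legendre \<tau> P"
  shows "degree (P k) = k" "poly (P k) 0 = 1" "j \<noteq> k \<Longrightarrow> inner_on \<tau> (P j) (P k) = 0" "P k \<noteq> 0"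
proof -
  show 1: "poly (P k) 0 = 1" using assms by (simp add: shifted_Legendre_def)
  show "P k \<noteq> 0" using 1 by force
qed (use assms in \<open>auto simp: shifted_Legendre_def\<close>)

text \<open>One elimination step. Positive degree is assumed because \<open>degree 0 = 0\<close>:
  eliminating a constant would not lower the degree strictly.\<close>

lemma degree_diff_lead_less:
  fixes f g :: "'a::field poly"
  assumes "degree f \<le> degree g" "degree g > 0"
  shows "degree (f - smult (coeff f (degree g) / lead_coeff g) g) < degree g"
proof -
  have "coeff (f - smult (coeff f (degree g) / lead_coeff g) g) i = 0" if "i > degree g - 1" for i
  proof (cases "i = degree g")
    case True
    then show ?thesis using assms(2) by auto
  next
    case False
    then have "i > degree g" using that by simp
    then show ?thesis using assms(1) by (simp add: coeff_eq_0)
  qed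
  then have "degree (f - smult (coeff f (degree g) / lead_coeff g) g) \<le> degree g - 1"
    by (intro degree_le) auto
  then show ?thesis using assms(2) by linarith
qed

text \<open>Strong induction on the degree: subtracting the multiple of \<open>P n\<close> that
  kills the leading coefficient leaves a smaller case, and \<open>P n\<close> is orthogonal to
  \<open>P N\<close>.\<close>

lemma shifted_Legendre_orthogonal:
  assumes "shifted_Legendre \<tau> P" "f = 0 \<or> degree f < N"
  shows "inner_on \<tau> f (P N) = 0"
  using assms(2)
proof (induction "degree f" arbitrary: f rule: less_induct)
  case less
  note P = shifted_LegendreD[OF assms(1)]
  show ?case
  proof (cases "f = 0")
    case True
    then show ?thesis by (simp add: inner_on_0_left)
  next
    case False
    define n where "n = degree f"
    have n: "n < N" using less.prems False by (simp add: n_def)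
    define c where "c = coeff f n / coeff (P n) n"
    define g where "g = f - smult c (P n)"
    have g: "degree g < n" if "n > 0"
      using degree_diff_lead_less[of f "P n"] that by (simp add: g_def c_def n_def P)
    have g0: "g = 0" if "n = 0"
    proof -
      from that have "degree f = 0" "degree (P 0) = 0" by (simp_all add: n_def P)
      then obtain a b where "f = [:a:]" "P 0 = [:b:]" by (meson degree_eq_zeroE)
      moreover from this have "b \<noteq> 0" using P(4)[of 0] by auto
      ultimately show ?thesis using that by (simp add: g_def c_def)
    qed
    have "inner_on \<tau> g (P N) = 0"
      using g g0 n less.hyps[of g] by (cases "n = 0") (auto simp: n_def inner_on_0_left)
    moreover have "inner_on \<tau> f (P N) = inner_on \<tau> g (P N) + c * inner_on \<tau> (P n) (P N)"
      by (simp flip: inner_on_smult_left inner_on_add_left add: g_def)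
    ultimately show ?thesis using P(3)[of n N] n by simp
  qed
qed

lemma shifted_Legendre_moments:
  assumes "shifted_Legendre \<tau> P" "n < N"
  shows "integral {-\<tau>..0} (\<lambda>\<theta>. of_real \<theta> ^ n * poly (P N) (of_real \<theta>)) = 0"
proof -
  \<comment> \<open>Monomials are real on the real interval, so conjugation only moves
    \<open>cnj\<close> off \<open>P N\<close>.\<close>
  have "cnj (inner_on \<tau> (monom 1 n) (P N)) = 0"
    using shifted_Legendre_orthogonal[OF assms(1), of "monom 1 n" N] assms(2)
    by (simp add: degree_monom_eq)
  then show ?thesis by (simp add: inner_on_def integral_cnj poly_monom)
qed

text \<open>Eliminating the coefficient of degree \<open>N\<close> leaves a polynomial orthogonal to
  \<open>P N\<close>, so the elimination factor is the projection coefficient.\<close>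

lemma truncation_eq:
  assumes "\<tau> > 0" "shifted_Legendre \<tau> P" "degree f \<le> N" "N > 0"
  shows "truncation \<tau> P N f = f - smult (coeff f N / coeff (P N) N) (P N)"
proof -
  note P = shifted_LegendreD[OF assms(2)]
  define c where "c = coeff f N / coeff (P N) N"
  have "degree (f - smult c (P N)) < N"
    using degree_diff_lead_less[of f "P N"] assms(3,4) by (simp add: c_def P)
  then have "inner_on \<tau> (f - smult c (P N)) (P N) = 0"
    by (intro shifted_Legendre_orthogonal[OF assms(2)]) simp
  moreover have "inner_on \<tau> f (P N) =
      inner_on \<tau> (f - smult c (P N)) (P N) + c * inner_on \<tau> (P N) (P N)"
    by (simp flip: inner_on_smult_left inner_on_add_left)
  ultimately have "inner_on \<tau> f (P N) / of_real ((norm_on \<tau> (P N))\<^sup>2) = c"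
    using inner_on_self_neq_0[OF assms(1) P(4)] by (simp only: of_real_norm_on_power2) simp
  then show ?thesis by (simp only: truncation_def c_def)
qed

section \<open>Solution of the tau equation\<close>

text \<open>The polynomial \<open>G s\<close> in \<theta>, for fixed \<open>s\<close>.\<close>

definition tau_poly :: "complex poly \<Rightarrow> complex \<Rightarrow> complex poly" where
  "tau_poly p s = (\<Sum>k\<le>degree p. smult (s ^ (degree p - k)) ((pderiv ^^ k) p))"

text \<open>The same sum read as a polynomial in \<open>s\<close> at a fixed point \<open>x\<close>;
  \<open>x = 0\<close> yields the Pade denominator and \<open>x = -\<tau>\<close> the
  numerator.\<close>

definition tau_eval_poly :: "complex poly \<Rightarrow> complex \<Rightarrow> complex poly" where
  "tau_eval_poly p x = (\<Sum>k\<le>degree p. monom (poly ((pderiv ^^ k) p) x) (degree p - k))"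

lemma poly_tau_eval_poly: "poly (tau_eval_poly p x) s = poly (tau_poly p s) x"
  by (simp add: tau_eval_poly_def tau_poly_def poly_sum poly_monom mult.commute)

lemma coeff_tau_eval_poly:
  "coeff (tau_eval_poly p x) n = (if n \<le> degree p then poly ((pderiv ^^ (degree p - n)) p) x else 0)"
proof -
  have "coeff (tau_eval_poly p x) n =
      (\<Sum>k\<le>degree p. if k = degree p - n \<and> n \<le> degree p then poly ((pderiv ^^ k) p) x else 0)"
    unfolding tau_eval_poly_def coeff_sum by (intro sum.cong) auto
  then show ?thesis by (cases "n \<le> degree p") auto
qed

lemma degree_tau_eval_poly: "degree (tau_eval_poly p x) \<le> degree p"
  by (rule degree_le) (simp add: coeff_tau_eval_poly)

lemma pderiv_sum: "pderiv (\<Sum>i\<in>A. f i) = (\<Sum>i\<in>A. pderiv (f i))"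
  by (induction A rule: infinite_finite_induct) (simp_all add: pderiv_add)

lemma smult_sum_right: "smult c (\<Sum>i\<in>A. f i) = (\<Sum>i\<in>A. smult c (f i))"
  by (induction A rule: infinite_finite_induct) (simp_all add: smult_add_right)

lemma degree_higher_pderiv: "degree ((pderiv ^^ k) (p :: complex poly)) = degree p - k"
  by (induction k) (simp_all add: degree_pderiv)

lemma higher_pderiv_Suc_degree: "(pderiv ^^ Suc (degree p)) (p :: complex poly) = 0"
  by (simp add: pderiv_eq_0_iff degree_higher_pderiv)

text \<open>This coefficient is the top derivative of \<open>p\<close>, the nonzero constant
  \<open>fact (degree p) * lead_coeff p\<close>. It keeps the denominator nonzero at
  \<open>s = 0\<close>.\<close>

lemma tau_eval_poly_0_neq_0:
  assumes "p \<noteq> 0"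
  shows "coeff (tau_eval_poly p x) 0 \<noteq> 0"
proof -
  have "coeff ((pderiv ^^ degree p) p) 0 \<noteq> 0"
    using assms by (simp add: coeff_higher_pderiv flip: pochhammer_fact)
  moreover obtain a where "(pderiv ^^ degree p) p = [:a:]"
    using degree_higher_pderiv[of "degree p" p] by (metis degree_eq_zeroE diff_self_eq_0)
  ultimately show ?thesis by (simp add: coeff_tau_eval_poly)
qed

lemma degree_tau_poly: "degree (tau_poly p s) \<le> degree p"
  unfolding tau_poly_def
  by (intro degree_sum_le) (auto intro: order_trans[OF degree_smult_le] simp: degree_higher_pderiv)

lemma coeff_tau_poly_degree: "coeff (tau_poly p s) (degree p) = s ^ degree p * lead_coeff p"
proof -
  have "coeff (tau_poly p s) (degree p) = (\<Sum>k\<le>degree p. if k = 0 then s ^ degree p * lead_coeff p else 0)"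
    unfolding tau_poly_def coeff_sum
    by (intro sum.cong) (auto simp: degree_higher_pderiv coeff_eq_0)
  then show ?thesis by simp
qed

text \<open>Differentiation shifts the summation index; the top term dies, and factoring out
  \<open>s\<close> restores every term of the sum except \<open>k = 0\<close>. By
  \<open>coeff_tau_poly_degree\<close> the subtracted term is exactly what
  \<open>truncation_eq\<close> removes.\<close>

lemma pderiv_tau_poly:
  "pderiv (tau_poly p s) = smult s (tau_poly p s - smult (s ^ degree p) p)"
proof -
  let ?N = "degree p"
  let ?D = "\<lambda>k. (pderiv ^^ k) p"
  have "pderiv (tau_poly p s) = (\<Sum>k\<le>?N. smult (s ^ (?N - k)) (?D (Suc k)))"
    by (simp add: tau_poly_def pderiv_sum pderiv_smult)
  also have "\<dots> = (\<Sum>k<?N. smult (s ^ (?N - k)) (?D (Suc k)))"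
    unfolding lessThan_Suc_atMost[symmetric] sum.lessThan_Suc
    using higher_pderiv_Suc_degree[of p] by simp
  also have "\<dots> = smult s (\<Sum>k<?N. smult (s ^ (?N - Suc k)) (?D (Suc k)))"
    unfolding smult_sum_right
  proof (intro sum.cong refl)
    fix k assume "k \<in> {..<?N}"
    then have "?N - k = Suc (?N - Suc k)" by auto
    then show "smult (s ^ (?N - k)) (?D (Suc k)) = smult s (smult (s ^ (?N - Suc k)) (?D (Suc k)))"
      by (simp only: power_Suc smult_smult)
  qed
  also have "(\<Sum>k<?N. smult (s ^ (?N - Suc k)) (?D (Suc k))) = tau_poly p s - smult (s ^ ?N) p"
    unfolding tau_poly_def sum.atMost_shift by simp
  finally show ?thesis .
qed

text \<open>Differentiation lowers a positive degree while scaling by \<open>s\<close> preserves it,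
  so \<open>u\<close> is constant.\<close>

lemma pderiv_eq_smult_imp_0:
  fixes u :: "complex poly"
  assumes "pderiv u = smult s u" "s \<noteq> 0"
  shows "u = 0"
proof -
  have "degree u - 1 = degree u"
    using arg_cong[OF assms(1), of degree] assms(2) by (simp add: degree_pderiv)
  then have "pderiv u = 0" by (simp add: pderiv_eq_0_iff)
  with assms show ?thesis by simp
qed

lemma tau_solution_iff:
  assumes "\<tau> > 0" "N > 0" "shifted_Legendre \<tau> P" "poly (tau_eval_poly (P N) 0) s \<noteq> 0"
  shows "tau_solution \<tau> P N s f \<longleftrightarrow>
    f = smult (1 / poly (tau_eval_poly (P N) 0) s) (tau_poly (P N) s)"
proof -
  note P = shifted_LegendreD[OF assms(3)]
  define p where "p = P N"
  define G where "G = tau_poly p s"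
  define Q where "Q = poly G 0"
  have Q: "Q \<noteq> 0" "poly (tau_eval_poly (P N) 0) s = Q"
    using assms(4) by (simp_all add: poly_tau_eval_poly Q_def G_def p_def)
  have p: "degree p = N" "coeff p N \<noteq> 0"
    using leading_coeff_neq_0[OF P(4)[of N]] by (simp_all add: p_def P(1))
  have dG: "degree G \<le> N" using degree_tau_poly[of p s] by (simp add: G_def p)
  have G': "pderiv G = smult s (G - smult (s ^ N) p)"
    using pderiv_tau_poly[of p s] by (simp add: G_def p)
  have cG: "coeff G N = s ^ N * coeff p N"
    using coeff_tau_poly_degree[of p s] by (simp add: G_def p)
  have iff: "tau_solution \<tau> P N s f \<longleftrightarrow> degree f \<le> N \<and> poly f 0 = 1 \<and>
      pderiv f = smult s (f - smult (coeff f N / coeff p N) p)" for f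
    using truncation_eq[OF assms(1,3) _ assms(2)] by (auto simp: tau_solution_def p_def)
  have sol: "tau_solution \<tau> P N s (smult (1 / Q) G)"
    unfolding iff using p Q(1) dG
    by (auto simp: pderiv_smult G' cG smult_diff_right simp flip: Q_def)
  have "f = smult (1 / Q) G" if f: "tau_solution \<tau> P N s f" for f
  \<comment> \<open>At \<open>s = 0\<close> the comparison with \<open>s ^ N\<close> below
    degenerates, but there the equation forces the constant 1.\<close>
  proof (cases "s = 0")
    case True
    have "g = [:1:]" if "tau_solution \<tau> P N s g" for g
    proof -
      have "pderiv g = 0" "poly g 0 = 1" using that[unfolded iff] True by simp_all
      then obtain a where "g = [:a:]" unfolding pderiv_eq_0_iff by (metis degree_eq_zeroE)
      with \<open>poly g 0 = 1\<close> show ?thesis by simp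
    qed
    with f sol show ?thesis by metis
  next
    case False
    define c where "c = coeff f N / coeff p N"
    have f1: "poly f 0 = 1" and f': "pderiv f = smult s (f - smult c p)"
      using f by (auto simp: iff c_def)
    \<comment> \<open>In this combination the inhomogeneous terms in \<open>p\<close> cancel,
      leaving a solution of \<open>u' = s u\<close>.\<close>
    have "smult (s ^ N) f - smult c G = 0"
      using False
      by (intro pderiv_eq_smult_imp_0[of _ s])
         (auto simp: pderiv_diff pderiv_smult f' G' algebra_simps smult_diff_right)
    then have eq: "smult (s ^ N) f = smult c G" by simp
    \<comment> \<open>The normalization at 0 determines \<open>c\<close>.\<close>
    from arg_cong[OF this, of "\<lambda>h. poly h 0"] have "s ^ N = c * Q"
      by (simp add: f1 Q_def)
    with False Q(1) have c: "c = s ^ N / Q" by simp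
    have "f = smult (1 / s ^ N) (smult (s ^ N) f)" using False by simp
    also have "\<dots> = smult (1 / Q) G" unfolding eq c using False by simp
    finally show ?thesis .
  qed
  with sol show ?thesis unfolding Q(2) unfolding p_def[symmetric] G_def[symmetric] by metis
qed

section \<open>Order of contact with the exponential\<close>

text \<open>Differentiation in \<theta>, acting on coefficients; the series variable
  \<open>fps_X\<close> stands for \<open>s\<close>.\<close>

definition fps_pderiv :: "complex poly fps \<Rightarrow> complex poly fps" where
  "fps_pderiv F = Abs_fps (\<lambda>n. pderiv (fps_nth F n))"

lemma fps_pderiv_mult: "fps_pderiv (F * G) = fps_pderiv F * G + F * fps_pderiv G"
proof (rule fps_ext)
  fix n
  show "fps_nth (fps_pderiv (F * G)) n = fps_nth (fps_pderiv F * G + F * fps_pderiv G) n"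
    unfolding fps_pderiv_def fps_add_nth fps_mult_nth fps_nth_Abs_fps pderiv_sum pderiv_mult
      sum.distrib[symmetric]
    by (simp add: algebra_simps)
qed

text \<open>The expansion of \<open>exp (- s * \<theta>)\<close> in powers of
  \<open>s\<close>.\<close>

definition fps_exp_neg_poly :: "complex poly fps" where
  "fps_exp_neg_poly = Abs_fps (\<lambda>n. smult (1 / fact n) ([:0, -1:] ^ n))"

text \<open>The sum \<open>G s\<close> again, now ordered by powers of \<open>s\<close>.\<close>

definition fps_tau :: "complex poly \<Rightarrow> complex poly fps" where
  "fps_tau p = Abs_fps (\<lambda>n. if n \<le> degree p then (pderiv ^^ (degree p - n)) p else 0)"

lemma fps_pderiv_exp_neg_poly: "fps_pderiv fps_exp_neg_poly = - fps_X * fps_exp_neg_poly"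
proof (rule fps_ext)
  fix n
  show "fps_nth (fps_pderiv fps_exp_neg_poly) n = fps_nth (- fps_X * fps_exp_neg_poly) n"
  proof (cases n)
    case 0
    then show ?thesis by (simp add: fps_pderiv_def fps_exp_neg_poly_def)
  next
    case (Suc m)
    have "pderiv [:0, -1 :: complex:] = [:-1:]" by (simp add: pderiv_pCons)
    moreover have "(- 1 - of_nat m) / fact (Suc m) = - (1 / fact m :: complex)"
    proof -
      have "- 1 - of_nat m = - (of_nat (Suc m) :: complex)" by simp
      moreover have "of_nat (Suc m) / fact (Suc m) = (1 / fact m :: complex)"
        by (simp del: of_nat_Suc)
      ultimately show ?thesis by (metis minus_divide_left)
    qed
    ultimately show ?thesis using Suc
      by (simp add: fps_pderiv_def fps_exp_neg_poly_def pderiv_smult pderiv_power_Suc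
          del: power_Suc fact_Suc)
  qed
qed

lemma fps_pderiv_tau:
  "fps_pderiv (fps_tau p) = fps_X * fps_tau p - fps_X ^ Suc (degree p) * fps_const p"
proof (rule fps_ext)
  fix n
  show "fps_nth (fps_pderiv (fps_tau p)) n =
    fps_nth (fps_X * fps_tau p - fps_X ^ Suc (degree p) * fps_const p) n"
  proof (cases n)
    case 0
    then show ?thesis using higher_pderiv_Suc_degree[of p]
      by (simp add: fps_pderiv_def fps_tau_def fps_X_power_mult_nth del: power_Suc)
  next
    case (Suc m)
    consider "m < degree p" | "m = degree p" | "m > degree p" by linarith
    then show ?thesis
    proof cases
      case 1
      then have "degree p - m = Suc (degree p - Suc m)" by simp
      with 1 Suc show ?thesis
        by (simp add: fps_pderiv_def fps_tau_def fps_X_power_mult_nth del: power_Suc)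
    qed (simp_all add: Suc fps_pderiv_def fps_tau_def fps_X_power_mult_nth del: power_Suc)
  qed
qed

text \<open>The product rule gives two opposite terms
  \<open>fps_X * fps_exp_neg_poly * fps_tau p\<close>; only the part divisible by
  \<open>fps_X ^ Suc (degree p)\<close> survives.\<close>

lemma fps_pderiv_exp_neg_mult_tau:
  "fps_pderiv (fps_exp_neg_poly * fps_tau p) =
    - (fps_X ^ Suc (degree p) * (fps_exp_neg_poly * fps_const p))"
  by (simp add: fps_pderiv_mult fps_pderiv_exp_neg_poly fps_pderiv_tau algebra_simps)

lemma poly_exp_neg_mult_tau_nth:
  "poly (fps_nth (fps_exp_neg_poly * fps_tau p) n) x =
    fps_nth (fps_exp (- x) * fps_of_poly (tau_eval_poly p x)) n"
  unfolding fps_mult_nth poly_sum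
  by (intro sum.cong)
     (auto simp: fps_exp_neg_poly_def fps_tau_def coeff_tau_eval_poly poly_power)

lemma integral_poly_pderiv:
  assumes "a \<le> b"
  shows "integral {a..b} (\<lambda>x. poly (pderiv p) (of_real x)) =
    poly p (of_real b) - poly (p :: complex poly) (of_real a)"
proof -
  have "((\<lambda>x. poly p (of_real x)) has_vector_derivative poly (pderiv p) (of_real x))
      (at x within {a..b})" for x :: real
    by (intro has_vector_derivative_real_field) (rule poly_DERIV)
  then show ?thesis
    by (intro integral_unique fundamental_theorem_of_calculus assms)
qed

text \<open>The two sides are the values at 0 and at \<open>-\<tau>\<close> of one coefficient
  \<open>H\<close>, a polynomial in \<theta>. They agree because the integral of
  \<open>pderiv H\<close> vanishes, trivially for \<open>n \<le> degree p\<close> and by the moment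
  conditions beyond.\<close>

lemma tau_eval_poly_nth_eq:
  assumes "\<tau> \<ge> 0" "n \<le> 2 * degree p"
    and "\<And>m. m < degree p \<Longrightarrow>
      integral {-\<tau>..0} (\<lambda>\<theta>. of_real \<theta> ^ m * poly p (of_real \<theta>)) = 0"
  shows "coeff (tau_eval_poly p 0) n =
    fps_nth (fps_exp (of_real \<tau>) * fps_of_poly (tau_eval_poly p (- of_real \<tau>))) n"
proof -
  define H where "H = fps_nth (fps_exp_neg_poly * fps_tau p) n"
  have H': "pderiv H = - fps_nth (fps_X ^ Suc (degree p) * (fps_exp_neg_poly * fps_const p)) n"
    using fps_pderiv_exp_neg_mult_tau[of p]
    by (simp add: fps_eq_iff fps_pderiv_def H_def)
  have "integral {-\<tau>..0} (\<lambda>\<theta>. poly (pderiv H) (of_real \<theta>)) = 0"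
  proof (cases "n \<le> degree p")
    case True
    then have "pderiv H = 0" unfolding H' fps_X_power_mult_nth by simp
    then show ?thesis by simp
  next
    case False
    \<comment> \<open>Here \<open>pderiv H\<close> is a multiple of \<open>\<theta> ^ m * p\<close>,
      and \<open>n \<le> 2 * degree p\<close> is what keeps \<open>m\<close> among the vanishing
      moments.\<close>
    define m where "m = n - Suc (degree p)"
    have "m < degree p" using False assms(2) by (simp add: m_def)
    have "poly (pderiv H) x = (- ((-1) ^ m / fact m)) * (x ^ m * poly p x)" for x
      using False unfolding H' fps_X_power_mult_nth
      by (simp add: fps_exp_neg_poly_def poly_power power_minus[of x] flip: m_def)
    then show ?thesis
      using assms(3)[OF \<open>m < degree p\<close>] by (simp only: integral_mult_right) simp
  qed
  with integral_poly_pderiv[of "-\<tau>" 0 H] assms(1) have "poly H 0 = poly H (- of_real \<tau>)"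
    by simp
  then show ?thesis by (simp add: H_def poly_exp_neg_mult_tau_nth)
qed

text \<open>Writing \<open>A\<close> as \<open>fps_exp c * B\<close> plus a multiple of
  \<open>fps_X ^ k\<close>, multiplication by \<open>fps_exp (- c)\<close> and by the inverse of the
  unit \<open>A\<close> keeps the error divisible by \<open>fps_X ^ k\<close>.\<close>

lemma fps_exp_eq_divide_nth:
  fixes A B :: "complex fps"
  assumes "fps_nth A 0 \<noteq> 0" "\<And>n. n < k \<Longrightarrow> fps_nth A n = fps_nth (fps_exp c * B) n" "n < k"
  shows "fps_nth (B / A) n = fps_nth (fps_exp (- c)) n"
proof -
  define K where "K = fps_shift k (A - fps_exp c * B)"
  have "A - fps_exp c * B = K * fps_X ^ k"
    unfolding K_def
    by (rule fps_ext) (use assms(2) in \<open>auto simp: fps_X_power_mult_right_nth\<close>)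
  then have A: "A = fps_exp c * B + K * fps_X ^ k" by (simp add: algebra_simps)
  have AI: "A * inverse A = 1" using assms(1) by (simp add: inverse_mult_eq_1')
  have EE: "fps_exp (- c) * fps_exp c = 1" by (simp flip: fps_exp_add_mult)
  have "fps_exp (- c) = fps_exp (- c) * (A * inverse A)" by (simp add: AI)
  also have "\<dots> = fps_exp (- c) * (fps_exp c * B + K * fps_X ^ k) * inverse A"
    by (metis A mult.assoc)
  also have "\<dots> = (fps_exp (- c) * fps_exp c) * B * inverse A
      + fps_exp (- c) * K * inverse A * fps_X ^ k"
    by (simp add: algebra_simps)
  also have "\<dots> = B / A + fps_exp (- c) * K * inverse A * fps_X ^ k"
    using assms(1) by (simp add: EE fps_divide_unit)
  finally have "fps_exp (- c) = B / A + fps_exp (- c) * K * inverse A * fps_X ^ k" .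
  then have "fps_nth (fps_exp (- c)) n =
      fps_nth (B / A + fps_exp (- c) * K * inverse A * fps_X ^ k) n"
    by (rule arg_cong)
  then show ?thesis using assms(3) by (simp add: fps_X_power_mult_right_nth)
qed

lemma has_fps_expansion_poly: "poly (p :: complex poly) has_fps_expansion fps_of_poly p"
proof (induction p)
  case 0
  then show ?case by (simp add: has_fps_expansion_0)
next
  case (pCons a p)
  have "(\<lambda>x. a + x * poly p x) has_fps_expansion fps_const a + fps_X * fps_of_poly p"
    by (intro fps_expansion_intros pCons)
  then show ?case by (simp add: fps_of_poly_pCons mult.commute)
qed

theorem theorem4p2:
  fixes \<tau> :: real and N :: nat and P :: "nat \<Rightarrow> complex poly"
  assumes "\<tau> > 0" and "N \<ge> 1"
    and "shifted_Legendre \<tau> P"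
  shows "(\<forall>\<^sub>F s in cofinite. \<exists>!f. tau_solution \<tau> P N s f) \<and>
         Pade_exp \<tau> N (\<lambda>s. poly (r_N \<tau> P N s) (- of_real \<tau>))"
proof -
  note P = shifted_LegendreD[OF assms(3)]
  define q where "q = tau_eval_poly (P N) 0"
  define p where "p = tau_eval_poly (P N) (- of_real \<tau>)"
  define R where "R = (\<lambda>s. poly (r_N \<tau> P N s) (- of_real \<tau>))"
  have q0: "coeff q 0 \<noteq> 0" unfolding q_def by (rule tau_eval_poly_0_neq_0) (rule P)
  then have "q \<noteq> 0" by auto
  \<comment> \<open>The exceptional values of \<open>s\<close> are confined to the roots of the
    denominator \<open>q\<close>.\<close>
  then have fin: "\<forall>\<^sub>F s in cofinite. poly q s \<noteq> 0"
    by (simp add: eventually_cofinite poly_roots_finite)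
  have iff: "tau_solution \<tau> P N s f \<longleftrightarrow> f = smult (1 / poly q s) (tau_poly (P N) s)"
    if "poly q s \<noteq> 0" for s f
    using tau_solution_iff[OF assms(1) _ assms(3)] assms(2) that by (simp add: q_def)
  have R: "R s = poly p s / poly q s" if "poly q s \<noteq> 0" for s
  proof -
    have "r_N \<tau> P N s = smult (1 / poly q s) (tau_poly (P N) s)"
      unfolding r_N_def by (rule the_equality) (simp_all add: iff[OF that])
    then show ?thesis by (simp add: R_def p_def poly_tau_eval_poly)
  qed
  \<comment> \<open>The neighbourhood includes 0 itself, so \<open>R\<close> equals the quotient
    there too and inherits its power series expansion.\<close>
  have ev: "\<forall>\<^sub>F s in nhds 0. poly q s \<noteq> 0"
  proof (rule eventually_nhds_in_open[THEN eventually_mono])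
    show "open {s. poly q s \<noteq> 0}"
      by (rule open_Collect_neq) (intro continuous_intros)+
  qed (use q0 in \<open>auto simp: poly_0_coeff_0\<close>)
  have "(\<lambda>s. poly p s / poly q s) has_fps_expansion fps_of_poly p / fps_of_poly q"
    using q0 by (intro has_fps_expansion_divide' has_fps_expansion_poly) simp
  then have exp: "R has_fps_expansion fps_of_poly p / fps_of_poly q"
    using ev by (subst has_fps_expansion_cong[OF _ refl]) (auto elim!: eventually_mono simp: R)
  have deriv: "(deriv ^^ m) R 0 = (- of_real \<tau>) ^ m" if "m \<le> 2 * N" for m
  proof -
    have "fps_nth (fps_of_poly p / fps_of_poly q) m = fps_nth (fps_exp (- of_real \<tau>)) m"
    \<comment> \<open>Contact modulo \<open>fps_X ^ Suc (2 * N)\<close> covers all orders up to and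
      including \<open>2 * N\<close>.\<close>
    proof (rule fps_exp_eq_divide_nth[where k = "Suc (2 * N)"])
      fix n assume "n < Suc (2 * N)"
      then show "fps_nth (fps_of_poly q) n = fps_nth (fps_exp (of_real \<tau>) * fps_of_poly p) n"
        using tau_eval_poly_nth_eq[of \<tau> n "P N"] shifted_Legendre_moments[OF assms(3)] assms(1)
        by (simp add: P q_def p_def)
    qed (use q0 that in auto)
    then show ?thesis by (simp add: fps_nth_fps_expansion[OF exp])
  qed
  have "Pade_exp \<tau> N R"
    unfolding Pade_exp_def
  proof (intro conjI exI allI impI)
    show "degree p \<le> N" "degree q \<le> N"
      using degree_tau_eval_poly[of "P N"] by (simp_all add: p_def q_def P)
    show "\<forall>\<^sub>F s in cofinite. R s = poly p s / poly q s"
      using fin by (rule eventually_mono) (rule R)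
  qed (use \<open>q \<noteq> 0\<close> deriv has_fps_expansion_imp_analytic_0[OF exp] in auto)
  moreover have "\<forall>\<^sub>F s in cofinite. \<exists>!f. tau_solution \<tau> P N s f"
    using fin by (rule eventually_mono) (simp add: iff)
  ultimately show ?thesis by (simp add: R_def)
qed

end
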